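(* Let $F$ be a finite field, $G$ a group, and $p \in F[G]$ a group ring element with support size at least two. Let $f_p : F^G \to F^G$, $f_p(x) = x \cdot p$, and $X_p = \{x \in F^G : x \cdot p = 0\}$. (1) If $X_p$ has at least two configurations, then Kaplansky's unit conjecture holds for $p$, i.e. $p$ does not have a right inverse in $F[G]$. (2) If Gottschalk's surjunctivity conjecture holds for $f_p$ (i.e. if $f_p$ is injective then $f_p$ is surjective) and Kaplansky's unit conjecture holds for $p$ (i.e. $p$ does not have a right inverse in $F[G]$), then $X_p$ has at least $|F|$ configurations.
   Context: $F[G]$ is the group ring, the finite formal sums $\sum_g p_g g$ with $p_g \in F$; the support of $p$ is $\{g : p_g \neq 0\}$. A configuration $x \in F^G$ is identified with the (possibly infinite) formal sum $\sum_{g \in G} x_g \cdot g$, and $x \cdot p$ is the product of formal sums, i.e. $(x \cdot p)_h = \sum_{g \in G} x_{hg^{-1}} p_g$. *)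

theory Defs
  imports
    "HOL-Library.Poly_Mapping"
    "HOL-Library.Equipollence"
begin

text \<open>
  The group is a type of class \<^class>\<open>group_add\<close>: the operation is written additively but
  is not assumed commutative, so that \<open>h - g\<close> stands for the product of \<open>h\<close> with the inverse
  of \<open>g\<close>, in that order. The group ring is then the type \<open>'g \<Rightarrow>\<^sub>0 'f\<close> of finitely supported
  functions with its convolution product; the support of \<open>p\<close> is \<open>keys p\<close>.
\<close>

type_synonym ('g, 'f) configuration = "'g \<Rightarrow> 'f"

text \<open>
  The sum over the whole group reduces to the sum over the finite support of \<open>p\<close>.
\<close>

definition conv :: "('g::group_add, 'f::field) configuration \<Rightarrow> ('g \<Rightarrow>\<^sub>0 'f) \<Rightarrow> ('g, 'f) configuration"
  where "conv x p = (\<lambda>h. \<Sum>g\<in>Poly_Mapping.keys p. x (h - g) * Poly_Mapping.lookup p g)"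

definition right_mult_map :: "('g::group_add \<Rightarrow>\<^sub>0 'f::field) \<Rightarrow> ('g, 'f) configuration \<Rightarrow> ('g, 'f) configuration"
  where "right_mult_map p = (\<lambda>x. conv x p)"

definition annihilator_shift :: "('g::group_add \<Rightarrow>\<^sub>0 'f::field) \<Rightarrow> ('g, 'f) configuration set"
  where "annihilator_shift p = {x. conv x p = (\<lambda>_. 0)}"

definition gottschalk_holds_for :: "('c \<Rightarrow> 'c) \<Rightarrow> bool"
  where "gottschalk_holds_for f \<longleftrightarrow> (inj f \<longrightarrow> surj f)"

definition kaplansky_unit_holds_for :: "('g::group_add \<Rightarrow>\<^sub>0 'f::field) \<Rightarrow> bool"
  where "kaplansky_unit_holds_for p \<longleftrightarrow> \<not> (\<exists>q. p * q = 1)"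

end

theory Submission imports Defs "HOL.Vector_Spaces"
begin

text \<open>
  The space of configurations \<open>F\<^sup>G\<close> is the full linear dual of the group ring \<open>F[G]\<close>: a
  configuration \<open>x\<close> acts on \<open>q\<close> by \<open>\<langle>x, q\<rangle> = (\<Sum>g. x (- g) * q g)\<close>, the coefficient of \<open>x \<cdot> q\<close> at
  the identity. The coefficient of \<open>x \<cdot> p\<close> at \<open>h\<close> is then \<open>\<langle>x, p \<cdot> h\<^sup>-\<^sup>1\<rangle>\<close>, because translating
  by \<open>h\<^sup>-\<^sup>1\<close> moves \<open>h\<close> to the identity. As the elements \<open>p \<cdot> h\<^sup>-\<^sup>1\<close> span the right ideal \<open>p F[G]\<close>,
  the set \<open>X\<^sub>p\<close> is exactly the space of functionals that vanish on this ideal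
  (\<open>annihilator_shift_iff_pairing\<close>).

  Both parts follow from linear duality. If \<open>p\<close> has a right inverse, the ideal is all of
  \<open>F[G]\<close>, and only the zero functional vanishes on it. If \<open>p\<close> has no right inverse, the ideal
  is a subspace that misses \<open>1\<close>, and some functional vanishes on it while taking the value
  \<open>1\<close> at \<open>1\<close>. So \<open>X\<^sub>p\<close> is nonzero if and only if \<open>p\<close> has no right inverse
  (\<open>kaplansky_unit_iff_annihilator_nonzero\<close>). Finally, \<open>X\<^sub>p\<close> is closed under scalar
  multiplication, so one nonzero element of it yields a whole line, which has \<open>|F|\<close> elements.
\<close>

lemma poly_mapping_eq_sum_single:
  "q = (\<Sum>g\<in>Poly_Mapping.keys q. Poly_Mapping.single g (Poly_Mapping.lookup q g))"
  by (rule poly_mapping_eqI)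
    (auto simp: lookup_sum lookup_single when_def in_keys_iff)

text \<open>
  The value at the identity of the formal product \<open>x \<cdot> q\<close>. The inverse of \<open>g\<close> appears because
  the coefficient of \<open>x\<close> at \<open>- g\<close> meets that of \<open>q\<close> at \<open>g\<close>.
\<close>

definition pairing :: "('g::group_add, 'f::field) configuration \<Rightarrow> ('g \<Rightarrow>\<^sub>0 'f) \<Rightarrow> 'f"
  where "pairing x q = (\<Sum>g\<in>Poly_Mapping.keys q. x (- g) * Poly_Mapping.lookup q g)"

lemma pairing_superset:
  assumes "finite S" "Poly_Mapping.keys q \<subseteq> S"
  shows "pairing x q = (\<Sum>g\<in>S. x (- g) * Poly_Mapping.lookup q g)"
  unfolding pairing_def using assms
  by (intro sum.mono_neutral_left) (auto simp: in_keys_iff)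

lemma pairing_single [simp]: "pairing x (Poly_Mapping.single g c) = x (- g) * c"
  by (simp add: pairing_def)

lemma pairing_0 [simp]: "pairing x 0 = 0"
  by (simp add: pairing_def)

lemma pairing_add: "pairing x (q + r) = pairing x q + pairing x r"
proof -
  let ?S = "Poly_Mapping.keys q \<union> Poly_Mapping.keys r"
  have "pairing x s = (\<Sum>g\<in>?S. x (- g) * Poly_Mapping.lookup s g)" if "s \<in> {q, r, q + r}" for s
    using that Poly_Mapping.keys_add[of q r] by (intro pairing_superset) auto
  then show ?thesis
    by (simp add: lookup_add algebra_simps sum.distrib)
qed

lemma pairing_sum: "pairing x (sum f A) = (\<Sum>a\<in>A. pairing x (f a))"
  by (induction A rule: infinite_finite_induct) (auto simp: pairing_add)

text \<open>
  Scalars act on the right of the group ring. Multiplication by \<open>p\<close> on the left is then linear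
  by associativity alone, which makes \<open>p F[G]\<close> a subspace.
\<close>

definition scale_right :: "'f::field \<Rightarrow> ('g::group_add \<Rightarrow>\<^sub>0 'f) \<Rightarrow> ('g \<Rightarrow>\<^sub>0 'f)"
  where "scale_right c q = q * Poly_Mapping.single 0 c"

lemma vector_space_scale_right:
  "vector_space (scale_right :: 'f::field \<Rightarrow> ('g::group_add \<Rightarrow>\<^sub>0 'f) \<Rightarrow> ('g \<Rightarrow>\<^sub>0 'f))"
proof
  fix a b :: 'f and q :: "'g \<Rightarrow>\<^sub>0 'f"
  show "scale_right a (scale_right b q) = scale_right (a * b) q"
    by (simp add: scale_right_def mult.assoc mult_single mult.commute[of a b])
qed (simp_all add: scale_right_def distrib_right distrib_left single_add)

lemma scale_right_single [simp]:
  "scale_right c (Poly_Mapping.single g d) = Poly_Mapping.single g (d * c)"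
  by (simp add: scale_right_def mult_single)

lemma pairing_scale_right: "pairing x (scale_right c q) = pairing x q * c"
proof -
  have "scale_right c q =
      (\<Sum>g\<in>Poly_Mapping.keys q. Poly_Mapping.single g (Poly_Mapping.lookup q g * c))"
    unfolding scale_right_def
    using arg_cong[OF poly_mapping_eq_sum_single, of "\<lambda>r. r * Poly_Mapping.single 0 c" q]
    by (simp only: sum_distrib_right mult_single add_0_right)
  then show ?thesis
    by (simp add: pairing_sum pairing_def[of x q] sum_distrib_right mult.assoc)
qed

text \<open>
  Evaluating a functional \<open>\<phi>\<close> at the group elements determines it, since these form a basis;
  the inversion in \<open>pairing\<close> forces the inversion in the configuration.
\<close>

lemma linear_functional_eq_pairing:
  assumes "Vector_Spaces.linear scale_right (*) \<phi>"
  shows "\<phi> = pairing (\<lambda>g. \<phi> (Poly_Mapping.single (- g) 1))"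
proof
  fix q
  interpret \<phi>: Vector_Spaces.linear scale_right "(*)" \<phi>
    by (fact assms)
  have monomial: "\<phi> (Poly_Mapping.single g c) = \<phi> (Poly_Mapping.single g 1) * c" for g c
    using \<phi>.scale[of c "Poly_Mapping.single g 1"] by (simp add: mult.commute)
  have "\<phi> q = (\<Sum>g\<in>Poly_Mapping.keys q. \<phi> (Poly_Mapping.single g (Poly_Mapping.lookup q g)))"
    using arg_cong[OF poly_mapping_eq_sum_single, of \<phi> q] by (simp only: \<phi>.sum)
  also have "\<dots> = pairing (\<lambda>g. \<phi> (Poly_Mapping.single (- g) 1)) q"
    unfolding pairing_def minus_minus by (intro sum.cong refl monomial)
  finally show "\<phi> q = pairing (\<lambda>g. \<phi> (Poly_Mapping.single (- g) 1)) q" .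
qed

lemma conv_eq_pairing: "conv x p h = pairing x (p * Poly_Mapping.single (- h) 1)"
proof -
  have "p * Poly_Mapping.single (- h) 1 =
      (\<Sum>g\<in>Poly_Mapping.keys p. Poly_Mapping.single (g - h) (Poly_Mapping.lookup p g))"
    using arg_cong[OF poly_mapping_eq_sum_single, of "\<lambda>r. r * Poly_Mapping.single (- h) 1" p]
    by (simp only: sum_distrib_right mult_single add_uminus_conv_diff mult_1_right)
  then show ?thesis
    by (simp add: pairing_sum conv_def)
qed

text \<open>
  The configuration condition \<open>x \<cdot> p = 0\<close> says that \<open>x\<close> kills the right translates of \<open>p\<close> by
  group elements, and these span the right ideal that \<open>p\<close> generates.
\<close>

lemma annihilator_shift_iff_pairing:
  "x \<in> annihilator_shift p \<longleftrightarrow> (\<forall>q. pairing x (p * q) = 0)"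
proof
  assume "x \<in> annihilator_shift p"
  then have translates: "pairing x (p * Poly_Mapping.single g 1) = 0" for g
    using conv_eq_pairing[of x p "- g"] by (simp add: annihilator_shift_def)
  have monomials: "pairing x (p * Poly_Mapping.single g c) = 0" for g c
    using pairing_scale_right[of x c "p * Poly_Mapping.single g 1"] translates[of g]
    by (simp add: scale_right_def mult.assoc mult_single)
  show "\<forall>q. pairing x (p * q) = 0"
  proof
    fix q
    show "pairing x (p * q) = 0"
      using arg_cong[OF poly_mapping_eq_sum_single, of "\<lambda>r. pairing x (p * r)" q]
      by (simp add: sum_distrib_left pairing_sum monomials)
  qed
qed (auto simp: annihilator_shift_def conv_eq_pairing)

text \<open>
  A functional that vanishes on a subspace but not at a given vector outside it comes from
  extending a basis of the subspace by that vector.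
\<close>

lemma (in vector_space) exists_functional_separating:
  assumes "subspace W" "v \<notin> W"
  obtains \<phi> where "Vector_Spaces.linear scale (*) \<phi>" "\<phi> v = 1" "\<And>w. w \<in> W \<Longrightarrow> \<phi> w = 0"
proof -
  interpret pair: vector_space_pair scale "(*) :: 'a \<Rightarrow> 'a \<Rightarrow> 'a"
    by unfold_locales (simp_all add: algebra_simps)
  obtain B where B: "B \<subseteq> W" "independent B" "W \<subseteq> span B"
    by (rule maximal_independent_subset)
  have "span B \<subseteq> W"
    using B(1) assms(1) by (rule span_minimal)
  with assms(2) B(2) have "independent (insert v B)"
    by (intro independent_insertI) auto
  then obtain \<phi> where \<phi>: "Vector_Spaces.linear scale (*) \<phi>"
    "\<forall>b\<in>insert v B. \<phi> b = (if b = v then 1 else 0)"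
    using pair.linear_independent_extend[of "insert v B" "\<lambda>b. if b = v then 1 else 0"] by blast
  have "\<phi> b = 0" if "b \<in> B" for b
    using \<phi>(2) that B(1) assms(2) by auto
  then have "\<phi> w = 0" if "w \<in> W" for w
    using pair.linear_eq_0_on_span[OF \<phi>(1), of B w] that B(3) by auto
  with \<phi> show thesis
    by (intro that[of \<phi>]) auto
qed

text \<open>
  The right ideal \<open>p F[G]\<close> is proper exactly when it misses \<open>1\<close>, and a subspace is proper exactly
  when a nonzero functional vanishes on it.
\<close>

lemma kaplansky_unit_iff_annihilator_nonzero:
  "kaplansky_unit_holds_for p \<longleftrightarrow> (\<exists>x\<in>annihilator_shift p. x \<noteq> (\<lambda>_. 0))"
proof
  interpret V: vector_space scale_right
    by (rule vector_space_scale_right)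
  assume "kaplansky_unit_holds_for p"
  then have "1 \<notin> range ((*) p)"
    by (auto simp: kaplansky_unit_holds_for_def)
  moreover have "V.subspace (range ((*) p))"
    unfolding V.subspace_def
    by (auto simp: scale_right_def mult.assoc image_iff distrib_left[symmetric]
        intro: exI[of _ 0])
  ultimately obtain \<phi> where \<phi>: "Vector_Spaces.linear scale_right (*) \<phi>" "\<phi> 1 = 1"
    "\<And>w. w \<in> range ((*) p) \<Longrightarrow> \<phi> w = 0"
    using V.exists_functional_separating by metis
  define x where "x = (\<lambda>g. \<phi> (Poly_Mapping.single (- g) 1))"
  have "pairing x (p * q) = 0" for q
    using \<phi>(3) linear_functional_eq_pairing[OF \<phi>(1)] by (auto simp: x_def)
  then have "x \<in> annihilator_shift p"
    by (simp add: annihilator_shift_iff_pairing)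
  moreover have "x 0 = 1"
    using \<phi>(2) by (simp add: x_def)
  then have "x \<noteq> (\<lambda>_. 0)"
    by auto
  ultimately show "\<exists>x\<in>annihilator_shift p. x \<noteq> (\<lambda>_. 0)"
    by blast
next
  assume "\<exists>x\<in>annihilator_shift p. x \<noteq> (\<lambda>_. 0)"
  then obtain x where x: "x \<in> annihilator_shift p" "x \<noteq> (\<lambda>_. 0)"
    by blast
  show "kaplansky_unit_holds_for p"
    unfolding kaplansky_unit_holds_for_def
  proof
    assume "\<exists>q. p * q = 1"
    then obtain q where q: "p * q = 1"
      by blast
    have "x h = 0" for h
    proof -
      have "p * (q * Poly_Mapping.single (- h) 1) = Poly_Mapping.single (- h) 1"
        by (simp add: q flip: mult.assoc)
      then have "pairing x (Poly_Mapping.single (- h) 1) = 0"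
        using x(1) unfolding annihilator_shift_iff_pairing by metis
      then show ?thesis
        by simp
    qed
    with x(2) show False
      by auto
  qed
qed

lemma annihilator_shift_scale:
  assumes "x \<in> annihilator_shift p"
  shows "(\<lambda>g. c * x g) \<in> annihilator_shift p"
proof -
  have "conv (\<lambda>g. c * x g) p = (\<lambda>h. c * conv x p h)"
    by (simp add: conv_def sum_distrib_left mult.assoc)
  with assms show ?thesis
    by (simp add: annihilator_shift_def)
qed

lemma field_lepoll_annihilator_shift:
  fixes p :: "'g::group_add \<Rightarrow>\<^sub>0 'f::field"
  assumes "x \<in> annihilator_shift p" "x \<noteq> (\<lambda>_. 0)"
  shows "(UNIV :: 'f set) \<lesssim> annihilator_shift p"
proof -
  from assms(2) obtain g where "x g \<noteq> 0"
    by auto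
  then have "inj (\<lambda>c g. c * x g)"
    by (auto simp: inj_def dest: fun_cong[of _ _ g])
  with assms(1) show ?thesis
    unfolding lepoll_def by (auto intro: annihilator_shift_scale)
qed

theorem proposition73:
  fixes p :: "'g::group_add \<Rightarrow>\<^sub>0 'f::{field, finite}"
  assumes "card (Poly_Mapping.keys p) \<ge> 2"
  shows "({..<2::nat} \<lesssim> annihilator_shift p \<longrightarrow> kaplansky_unit_holds_for p) \<and>
         (gottschalk_holds_for (right_mult_map p) \<and> kaplansky_unit_holds_for p \<longrightarrow>
            (UNIV :: 'f set) \<lesssim> annihilator_shift p)"
proof (intro conjI impI)
  assume "{..<2::nat} \<lesssim> annihilator_shift p"
  then obtain y :: "nat \<Rightarrow> 'g \<Rightarrow> 'f"
    where y: "inj_on y {..<2}" "y ` {..<2} \<subseteq> annihilator_shift p"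
    by (auto simp: lepoll_def)
  have "y 0 \<noteq> y 1"
    using inj_onD[OF y(1), of 0 1] by auto
  then have "y 0 \<noteq> (\<lambda>_. 0) \<or> y 1 \<noteq> (\<lambda>_. 0)"
    by metis
  with y(2) show "kaplansky_unit_holds_for p"
    unfolding kaplansky_unit_iff_annihilator_nonzero by force
next
  assume "gottschalk_holds_for (right_mult_map p) \<and> kaplansky_unit_holds_for p"
  then show "(UNIV :: 'f set) \<lesssim> annihilator_shift p"
    using field_lepoll_annihilator_shift
    unfolding kaplansky_unit_iff_annihilator_nonzero by blast
qed

end
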